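(* Let $0<\alpha\le 2$, $m>0$, and let $x\in\Omega$, where $\Omega$ is the set of collision-free curves $x\in H^1(\mathbb T;(\mathbb R^2)^N)$. For $\lambda>0$ set $\Phi_\alpha(\lambda;x)=\mathcal A(\lambda x)=\lambda^2K(x)+\lambda^{-\alpha}V(x)$. Then $$\min_{\lambda>0}\Phi_\alpha(\lambda;x)=C_\alpha\,\mathcal F(x),\qquad \mathcal F(x)=K(x)^{\frac{\alpha}{\alpha+2}}\,V(x)^{\frac{2}{\alpha+2}},\qquad C_\alpha=\frac{\alpha+2}{2}\left(\frac{\alpha}{2}\right)^{-\frac{\alpha}{\alpha+2}}.$$
   Context: $\mathbb T:=\mathbb R/(2\pi\mathbb Z)$. For $x=(x_1,\dots,x_N):\mathbb T\to(\mathbb R^2)^N$: $K(x)=\frac12\int_0^{2\pi}\sum_{i=1}^N m|\dot x_i|^2\,dt$, $U(x)=\sum_{1\le i<j\le N}m^2|x_i-x_j|^{-\alpha}$, $V(x)=\int_0^{2\pi}U(x(t))\,dt$, $\mathcal A(x)=K(x)+V(x)$. Collision-free means $x_i(t)\neq x_j(t)$ for all $t$ and $i\neq j$.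
   Formalization: The minimum need not exist if x is constant (K=0<V) or N=1 (V=0<K); the formal theorem proves that the infimum over λ>0 equals C_α F(x) for every x in Ω, and that it is attained as a minimum when N≥2 and x is non-constant. *)

theory Defs
  imports "HOL-Analysis.Analysis"
begin

text \<open>
  Functions on \<open>\<real>/(2\<pi>\<int>)\<close> are \<open>2\<pi>\<close>-periodic functions on \<open>\<real>\<close>. A configuration of \<open>N\<close> planar
  bodies is a vector in \<open>(real^2)^'n\<close> with \<open>N = CARD('n)\<close>; the linear order on \<open>'n\<close> plays the role
  of the order on \<open>{1..N}\<close> and is used only to sum over pairs \<open>i < j\<close>.
\<close>

definition periodic_2pi :: "(real \<Rightarrow> 'b) \<Rightarrow> bool" where
  "periodic_2pi f \<longleftrightarrow> (\<forall>t. f (t + 2 * pi) = f t)"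

abbreviation circle_measure :: "real measure" where
  "circle_measure \<equiv> lebesgue_on {0..2 * pi}"

definition L2_circle :: "(real \<Rightarrow> 'b::euclidean_space) \<Rightarrow> bool" where
  "L2_circle v \<longleftrightarrow>
     v \<in> borel_measurable circle_measure \<and> integrable circle_measure (\<lambda>t. (norm (v t))\<^sup>2)"

text \<open>Distributional derivative on the circle, tested against periodic \<open>C\<^sup>1\<close> functions \<open>\<phi>\<close>
  with derivative \<open>\<phi>'\<close>. Only the values of \<open>v\<close> on \<open>[0, 2\<pi>]\<close> matter.\<close>

definition has_weak_derivative_circle ::
    "(real \<Rightarrow> 'b::euclidean_space) \<Rightarrow> (real \<Rightarrow> 'b) \<Rightarrow> bool" where
  "has_weak_derivative_circle x v \<longleftrightarrow>
     (\<forall>\<phi> \<phi>' :: real \<Rightarrow> real.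
        periodic_2pi \<phi> \<and> (\<forall>t. (\<phi> has_real_derivative \<phi>' t) (at t)) \<and> continuous_on UNIV \<phi>' \<longrightarrow>
        (\<integral>t. \<phi>' t *\<^sub>R x t \<partial>circle_measure) = - (\<integral>t. \<phi> t *\<^sub>R v t \<partial>circle_measure))"

text \<open>An element of \<open>H\<^sup>1\<close> is represented by its continuous representative, which is what
  the pointwise condition of being collision-free refers to; continuity and periodicity
  make it square integrable.\<close>

definition H1_circle :: "(real \<Rightarrow> 'b::euclidean_space) set" where
  "H1_circle = {x. periodic_2pi x \<and> continuous_on UNIV x \<and>
                   (\<exists>v. L2_circle v \<and> has_weak_derivative_circle x v)}"

text \<open>The choice is unique up to null sets, so it does not affect integrals.\<close>

definition weak_derivative_circle :: "(real \<Rightarrow> 'b::euclidean_space) \<Rightarrow> real \<Rightarrow> 'b" where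
  "weak_derivative_circle x = (SOME v. L2_circle v \<and> has_weak_derivative_circle x v)"

definition collision_free :: "(real \<Rightarrow> (real^2)^'n) \<Rightarrow> bool" where
  "collision_free x \<longleftrightarrow> (\<forall>t i j. i \<noteq> j \<longrightarrow> x t $ i \<noteq> x t $ j)"

definition collision_free_curves :: "(real \<Rightarrow> (real^2)^'n) set" where
  "collision_free_curves = {x \<in> H1_circle. collision_free x}"

definition kinetic :: "real \<Rightarrow> (real \<Rightarrow> (real^2)^'n) \<Rightarrow> real" where
  "kinetic m x =
     1 / 2 * (\<integral>t. (\<Sum>i\<in>UNIV. m * (norm (weak_derivative_circle x t $ i))\<^sup>2) \<partial>circle_measure)"

definition potential :: "real \<Rightarrow> real \<Rightarrow> (real^2)^('n::{finite,linorder}) \<Rightarrow> real" where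
  "potential \<alpha> m q = (\<Sum>(i, j)\<in>{(i, j). i < j}. m\<^sup>2 * norm (q $ i - q $ j) powr (- \<alpha>))"

definition potential_integral ::
    "real \<Rightarrow> real \<Rightarrow> (real \<Rightarrow> (real^2)^('n::{finite,linorder})) \<Rightarrow> real" where
  "potential_integral \<alpha> m x = (\<integral>t. potential \<alpha> m (x t) \<partial>circle_measure)"

definition action :: "real \<Rightarrow> real \<Rightarrow> (real \<Rightarrow> (real^2)^('n::{finite,linorder})) \<Rightarrow> real" where
  "action \<alpha> m x = kinetic m x + potential_integral \<alpha> m x"

definition scaled_action ::
    "real \<Rightarrow> real \<Rightarrow> real \<Rightarrow> (real \<Rightarrow> (real^2)^('n::{finite,linorder})) \<Rightarrow> real" where
  "scaled_action \<alpha> m l x = action \<alpha> m (\<lambda>t. l *\<^sub>R x t)"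

definition scale_invariant_functional ::
    "real \<Rightarrow> real \<Rightarrow> (real \<Rightarrow> (real^2)^('n::{finite,linorder})) \<Rightarrow> real" where
  "scale_invariant_functional \<alpha> m x =
     kinetic m x powr (\<alpha> / (\<alpha> + 2)) * potential_integral \<alpha> m x powr (2 / (\<alpha> + 2))"

definition scaling_constant :: "real \<Rightarrow> real" where
  "scaling_constant \<alpha> = (\<alpha> + 2) / 2 * (\<alpha> / 2) powr (- (\<alpha> / (\<alpha> + 2)))"

end

theory Submission
  imports Defs
begin

text \<open>
  Homogeneity gives \<open>A(l x) = l\<^sup>2 K + l powr (-\<alpha>) V\<close>, which for \<open>K\<close> requires that the chosen weak derivative
  be unique almost everywhere: an integrable function orthogonal to all periodic \<open>C\<^sup>1\<close> functions
  has vanishing integral over every interval, hence vanishes by Lebesgue differentiation. Young's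
  inequality with weights \<open>\<alpha>/(\<alpha>+2)\<close> and \<open>2/(\<alpha>+2)\<close> is then the lower bound, with equality at
  \<open>l = (\<alpha>V/2K)\<close> to the power \<open>1/(\<alpha>+2)\<close> when \<open>K, V > 0\<close>. If \<open>K = 0\<close> or \<open>V = 0\<close>, the infimum is
  \<open>0\<close>, approached as \<open>l \<rightarrow> \<infinity>\<close> or \<open>l \<rightarrow> 0\<close>. The same orthogonality argument shows that a curve with zero
  weak derivative is constant, since periodic functions of mean \<open>0\<close> have periodic antiderivatives.
\<close>

subsection \<open>Functions orthogonal to periodic \<open>C\<^sup>1\<close> functions\<close>

text \<open>Both parts compare the distance of \<open>t\<close> from the centre
  \<open>(a + b) / 2\<close> with the half-width \<open>(b - a) / 2\<close>, since cosine decreases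
  on [0, \<pi>]. They give the sign of a smooth periodic function that changes sign only at the ends
  of the arc.\<close>

lemma cos_arc_less:
  fixes a b t :: real
  assumes "0 \<le> a" "a < b" "b \<le> 2 * pi" "0 < t" "t < 2 * pi"
  shows "a < t \<Longrightarrow> t < b \<Longrightarrow> cos ((b - a) / 2) < cos (t - (a + b) / 2)"
    and "t < a \<or> b < t \<Longrightarrow> cos (t - (a + b) / 2) < cos ((b - a) / 2)"
proof -
  let ?r = "(b - a) / 2" and ?s = "\<bar>t - (a + b) / 2\<bar>"
  have c: "cos (t - (a + b) / 2) = cos ?s" by simp
  show "cos ?r < cos (t - (a + b) / 2)" if "a < t" "t < b"
  proof -
    have "?s < ?r" using that by (simp add: abs_if field_simps)
    then show ?thesis unfolding c using assms by (intro cos_monotone_0_pi) auto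
  qed
  show "cos (t - (a + b) / 2) < cos ?r" if "t < a \<or> b < t"
  proof -
    have rs: "?r < ?s" using that assms by (auto simp: abs_if field_simps)
    have s2: "?s < 2 * pi - ?r" using assms by (auto simp: abs_if field_simps)
    show ?thesis
    proof (cases "?s \<le> pi")
      case True
      then show ?thesis unfolding c using rs assms by (intro cos_monotone_0_pi) auto
    \<comment> \<open>Beyond \<pi> cosine increases again; the reflected distance
      \<open>2 * pi - ?s\<close> lies in [0, \<pi>] and by \<open>s2\<close> still exceeds
      \<open>?r\<close>.\<close>
    next
      case False
      have "cos (2 * pi - ?s) < cos ?r"
      proof (rule cos_monotone_0_pi)
        show "0 \<le> ?r" using assms by simp
        show "?r < 2 * pi - ?s" using s2 by (simp only: less_diff_eq add.commute)
        show "2 * pi - ?s \<le> pi" using False by simp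
      qed
      moreover have "cos (2 * pi - ?s) = cos ?s" by (simp add: cos_diff)
      ultimately show ?thesis unfolding c by simp
    qed
  qed
qed

text \<open>Steepening sigmoids tend to the Heaviside step; at \<open>s = 0\<close> they would stay
  at 1/2.\<close>

lemma arctan_scaled_tendsto:
  fixes s :: real
  assumes "s \<noteq> 0"
  shows "(\<lambda>k. 1 / 2 + arctan (real k * s) / pi) \<longlonglongrightarrow> (if 0 < s then 1 else 0)"
proof (cases "0 < s")
  case True
  have "filterlim (\<lambda>k. real k * s) at_top sequentially"
    using True filterlim_real_sequentially
    by (intro filterlim_at_top_mult_tendsto_pos[OF tendsto_const]) auto
  then have "(\<lambda>k. arctan (real k * s)) \<longlonglongrightarrow> pi / 2"
    by (rule filterlim_compose[OF tendsto_arctan_at_top])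
  then have "(\<lambda>k. 1 / 2 + arctan (real k * s) / pi) \<longlonglongrightarrow> 1 / 2 + (pi / 2) / pi"
    by (intro tendsto_intros) auto
  then show ?thesis using True by simp
next
  case False
  with assms have "0 < - s" by simp
  then have "filterlim (\<lambda>k. real k * (- s)) at_top sequentially"
    using filterlim_real_sequentially
    by (intro filterlim_at_top_mult_tendsto_pos[OF tendsto_const]) auto
  then have "(\<lambda>k. arctan (real k * (- s))) \<longlonglongrightarrow> pi / 2"
    by (rule filterlim_compose[OF tendsto_arctan_at_top])
  then have "(\<lambda>k. 1 / 2 - arctan (real k * (- s)) / pi) \<longlonglongrightarrow> 1 / 2 - (pi / 2) / pi"
    by (intro tendsto_intros) auto
  then show ?thesis using False by (simp add: arctan_minus)
qed

text \<open>Serves limits that may fail at the ends of the period or of an arc: these points form a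
  null set.\<close>

lemma AE_circle_interior:
  assumes "\<And>t. \<lbrakk>0 < t; t < 2 * pi; t \<noteq> a; t \<noteq> b\<rbrakk> \<Longrightarrow> P t"
  shows "AE t in circle_measure. P t"
proof -
  have "{0, 2 * pi, a, b} \<in> null_sets lebesgue"
    by (simp flip: negligible_iff_null_sets)
  then have "AE t in lebesgue. t \<notin> {0, 2 * pi, a, b}"
    by (rule AE_not_in)
  then have "AE t in lebesgue. t \<in> {0..2 * pi} \<longrightarrow> P t"
    by (rule eventually_mono) (use assms in force)
  then show ?thesis
    by (subst AE_restrict_space_iff) auto
qed

text \<open>A continuous factor is bounded on the compact period, so a multiple of
  \<open>norm (u t)\<close> dominates.\<close>

lemma integrable_circle_scaleR:
  fixes u :: "real \<Rightarrow> 'b::euclidean_space"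
  assumes u: "integrable circle_measure u" and \<phi>: "continuous_on {0..2 * pi} \<phi>"
  shows "integrable circle_measure (\<lambda>t. \<phi> t *\<^sub>R u t)"
proof -
  have "compact (\<phi> ` {0..2 * pi})"
    by (intro compact_continuous_image \<phi>) auto
  then obtain B where B: "\<And>t. t \<in> {0..2 * pi} \<Longrightarrow> norm (\<phi> t) \<le> B"
    unfolding bounded_iff[of "\<phi> ` _"] by (meson compact_imp_bounded bounded_iff imageI)
  show ?thesis
  proof (rule Bochner_Integration.integrable_bound)
    show "integrable circle_measure (\<lambda>t. B *\<^sub>R norm (u t))"
      using u by simp
    show "(\<lambda>t. \<phi> t *\<^sub>R u t) \<in> borel_measurable circle_measure"
      using u continuous_imp_measurable_on_sets_lebesgue[OF \<phi>] by auto
    have "norm (\<phi> t *\<^sub>R u t) \<le> norm (B *\<^sub>R norm (u t))" if "t \<in> {0..2 * pi}" for t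
      using mult_right_mono[OF B[OF that], of "norm (u t)"] by (simp add: abs_mult)
         (smt (verit) mult_nonneg_nonneg abs_ge_self norm_ge_zero mult_right_mono)
    then show "AE t in circle_measure. norm (\<phi> t *\<^sub>R u t) \<le> norm (B *\<^sub>R norm (u t))"
      by (intro AE_I2) auto
  qed
qed

text \<open>The indicator of an arc with centre \<open>c\<close> and half-width \<open>r\<close> is almost everywhere the
  bounded pointwise limit of the smooth periodic functions
  \<open>1/2 + arctan (k (cos (t - c) - cos r)) / \<pi>\<close>.\<close>

lemma integral_arc_eq_0:
  fixes u :: "real \<Rightarrow> 'b::euclidean_space"
  assumes u: "integrable circle_measure u"
    and orth: "\<And>\<phi> \<phi>' :: real \<Rightarrow> real. \<lbrakk>periodic_2pi \<phi>; \<And>t. (\<phi> has_real_derivative \<phi>' t) (at t);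
        continuous_on UNIV \<phi>'\<rbrakk> \<Longrightarrow> (\<integral>t. \<phi> t *\<^sub>R u t \<partial>circle_measure) = 0"
    and ab: "0 \<le> a" "a < b" "b \<le> 2 * pi"
  shows "(\<integral>t. indicator {a..b} t *\<^sub>R u t \<partial>circle_measure) = 0"
proof -
  define s where "s t = cos (t - (a + b) / 2) - cos ((b - a) / 2)" for t
  define \<phi> where "\<phi> k t = 1 / 2 + arctan (real k * s t) / pi" for k t
  have [measurable]: "u \<in> borel_measurable circle_measure"
    using u by auto
  have s: "(s has_real_derivative - sin (t - (a + b) / 2)) (at t)" for t
    unfolding s_def by (auto intro!: derivative_eq_intros)
  have cs: "continuous_on UNIV s"
    unfolding s_def by (intro continuous_intros)
  have c\<phi>: "continuous_on A (\<phi> k)" for A k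
    unfolding \<phi>_def by (intro continuous_intros continuous_on_subset[OF cs]) auto
  have "(\<integral>t. \<phi> k t *\<^sub>R u t \<partial>circle_measure) = 0" for k
  proof (rule orth)
    show "periodic_2pi (\<phi> k)"
      unfolding periodic_2pi_def \<phi>_def s_def by (simp add: cos_add cos_diff sin_add)
    show "(\<phi> k has_real_derivative
        (inverse (1 + (real k * s t)\<^sup>2) * (real k * - sin (t - (a + b) / 2)) / pi)) (at t)" for t
      using DERIV_add[OF DERIV_const DERIV_cdivide[OF DERIV_chain2[OF DERIV_arctan DERIV_cmult[OF s]]]]
      unfolding \<phi>_def by force
    have "1 + (real k * s t)\<^sup>2 \<noteq> 0" for t
      by (smt (verit) zero_le_power2)
    then show "continuous_on UNIV (\<lambda>t. inverse (1 + (real k * s t)\<^sup>2) * (real k * - sin (t - (a + b) / 2)) / pi)"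
      by (intro continuous_intros cs) auto
  qed
  moreover have "(\<lambda>k. \<integral>t. \<phi> k t *\<^sub>R u t \<partial>circle_measure)
      \<longlonglongrightarrow> (\<integral>t. indicator {a..b} t *\<^sub>R u t \<partial>circle_measure)"
  proof (rule integral_dominated_convergence[where w = "\<lambda>t. norm (u t)"])
    show "(\<lambda>t. \<phi> k t *\<^sub>R u t) \<in> borel_measurable circle_measure" for k
      using integrable_circle_scaleR[OF u c\<phi>] by auto
    have "{a..b} \<in> sets circle_measure"
      using ab by (subst sets_restrict_space_iff) auto
    then show "(\<lambda>t. indicat_real {a..b} t *\<^sub>R u t) \<in> borel_measurable circle_measure"
      by measurable
    show "integrable circle_measure (\<lambda>t. norm (u t))"
      using u by simp
    \<comment> \<open>As arctan lies between -\<pi>/2 and \<pi>/2, \<open>\<phi> k\<close> lies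
      between 0 and 1.\<close>
    have "norm (\<phi> k t) \<le> 1" for k t
      using arctan_bounded[of "real k * s t"] by (auto simp: \<phi>_def abs_le_iff field_simps)
    then show "AE t in circle_measure. norm (\<phi> k t *\<^sub>R u t) \<le> norm (u t)" for k
      by (simp add: mult_left_le_one_le)
    show "AE t in circle_measure. (\<lambda>k. \<phi> k t *\<^sub>R u t) \<longlonglongrightarrow> indicator {a..b} t *\<^sub>R u t"
    proof (rule AE_circle_interior[of a b])
      fix t assume t: "0 < t" "t < 2 * pi" "t \<noteq> a" "t \<noteq> b"
      have "s t \<noteq> 0" "indicator {a..b} t = (if 0 < s t then 1 else 0 :: real)"
        using cos_arc_less[OF ab t(1,2)] t(3,4) unfolding s_def
        by (auto simp: indicator_def) (smt (verit))+
      then have "(\<lambda>k. \<phi> k t) \<longlonglongrightarrow> indicator {a..b} t"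
        using arctan_scaled_tendsto[of "s t"] unfolding \<phi>_def by simp
      then show "(\<lambda>k. \<phi> k t *\<^sub>R u t) \<longlonglongrightarrow> indicator {a..b} t *\<^sub>R u t"
        by (intro tendsto_intros)
    qed
  qed
  ultimately show ?thesis
    by (simp add: LIMSEQ_const_iff)
qed

lemma AE_eq_0_if_orthogonal_to_C1:
  fixes u :: "real \<Rightarrow> 'b::euclidean_space"
  assumes u: "integrable circle_measure u"
    and orth: "\<And>\<phi> \<phi>' :: real \<Rightarrow> real. \<lbrakk>periodic_2pi \<phi>; \<And>t. (\<phi> has_real_derivative \<phi>' t) (at t);
        continuous_on UNIV \<phi>'\<rbrakk> \<Longrightarrow> (\<integral>t. \<phi> t *\<^sub>R u t \<partial>circle_measure) = 0"
  shows "AE t in circle_measure. u t = 0"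
proof -
  \<comment> \<open>Extension by zero to the whole line, where Lebesgue differentiation recovers
    \<open>f t\<close> off a negligible set \<open>N\<close> as the limit of means over
    \<open>[t, t + h]\<close>.\<close>
  define f where "f t = (if t \<in> {0..2 * pi} then u t else 0)" for t
  have "integrable lebesgue f"
    unfolding f_def using u by (subst Lebesgue_Measure.integrable_restrict_UNIV) auto
  then have f: "f integrable_on UNIV"
    by (rule integrable_on_lebesgue)
  obtain N where N: "negligible N" and lim: "\<And>t e. \<lbrakk>t \<notin> N; 0 < e\<rbrakk> \<Longrightarrow>
      \<exists>d>0. \<forall>h. 0 < h \<and> h < d \<longrightarrow> norm (integral (cbox t (t + h *\<^sub>R One)) f /\<^sub>R h ^ DIM(real) - f t) < e"
    using integrable_ccontinuous_explicit[of f] integrable_on_subcbox[OF f] by blast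
  have zero: "integral {a..b} f = 0" if ab: "0 \<le> a" "a < b" "b \<le> 2 * pi" for a b
  proof -
    have sub: "{a..b} \<subseteq> {0..2 * pi}" using ab by auto
    have ui: "integrable (lebesgue_on {a..b}) u"
      using u sub by (rule integrable_subinterval)
    have "integral {a..b} f = integral {a..b} u"
      using sub by (intro integral_cong) (auto simp: f_def)
    also have "\<dots> = integral\<^sup>L (lebesgue_on {a..b}) u"
      using ui by (simp add: lebesgue_integral_eq_integral)
    also have "\<dots> = (\<integral>t. indicator {a..b} t *\<^sub>R u t \<partial>circle_measure)"
    proof -
      have "indicat_real {0..2 * pi} t *\<^sub>R indicat_real {a..b} t *\<^sub>R u t = indicat_real {a..b} t *\<^sub>R u t" for t
        using sub by (auto simp: indicator_def)
      then show ?thesis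
        by (subst (1 2) integral_restrict_space) (simp_all only:, simp_all)
    qed
    also have "\<dots> = 0"
      using integral_arc_eq_0[OF u orth ab] .
    finally show ?thesis .
  qed
  have "f t = 0" if t: "0 \<le> t" "t < 2 * pi" "t \<notin> N" for t
  proof (rule ccontr)
    assume "f t \<noteq> 0"
    then obtain d where d: "d > 0"
      and *: "\<And>h. 0 < h \<Longrightarrow> h < d \<Longrightarrow> norm (integral {t..t + h} f /\<^sub>R h - f t) < norm (f t)"
      using lim[OF t(3), of "norm (f t)"] by auto
    \<comment> \<open>Small enough for the estimate and for \<open>[t, t + h]\<close> to stay in the
      period. The mean there is 0, so \<open>*\<close> would read
      \<open>norm (f t) < norm (f t)\<close>.\<close>
    define h where "h = min (d / 2) (2 * pi - t)"
    have "0 < h" "h < d" "t + h \<le> 2 * pi"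
      using d t by (auto simp: h_def)
    then show False
      using *[of h] zero[of t "t + h"] t by simp
  qed
  \<comment> \<open>The point \<open>2 * pi\<close> joins the exceptional set because no interval to
    its right lies in the period.\<close>
  then have f0: "f t = 0" if "t \<notin> insert (2 * pi) N" for t
    using that by (cases "0 \<le> t \<and> t < 2 * pi") (auto simp: f_def)
  have "insert (2 * pi) N \<in> null_sets lebesgue"
    using N by (simp flip: negligible_iff_null_sets)
  then have "AE t in lebesgue. t \<notin> insert (2 * pi) N"
    by (rule AE_not_in)
  then have "AE t in lebesgue. t \<in> {0..2 * pi} \<longrightarrow> u t = 0"
    by (rule eventually_mono) (metis f0 f_def)
  then show ?thesis
    by (subst AE_restrict_space_iff) auto
qed

subsection \<open>Weak derivatives on the circle\<close>

text \<open>The circle has finite measure, so the constant 1 is integrable, and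
  \<open>n \<le> 1 + n\<^sup>2\<close>.\<close>

lemma integrable_L2_circle:
  assumes "L2_circle v"
  shows "integrable circle_measure v"
proof (rule Bochner_Integration.integrable_bound)
  show "integrable circle_measure (\<lambda>t. 1 + (norm (v t))\<^sup>2)"
    using assms continuous_imp_integrable_real[of 0 "2 * pi" "\<lambda>_. 1 :: real"]
    unfolding L2_circle_def by (intro Bochner_Integration.integrable_add) auto
  show "v \<in> borel_measurable circle_measure"
    using assms by (simp add: L2_circle_def)
  have "n \<le> 1 + n\<^sup>2" for n :: real
  proof -
    have "2 * n \<le> n\<^sup>2 + 1"
      using zero_le_power2[of "n - 1"] by (simp add: power2_diff)
    then show ?thesis
      using zero_le_power2[of n] by linarith
  qed
  then show "AE t in circle_measure. norm (v t) \<le> norm (1 + (norm (v t))\<^sup>2)"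
    by (intro AE_I2) (metis real_norm_def abs_ge_self order_trans)
qed

lemma has_weak_derivative_circleD:
  assumes "has_weak_derivative_circle x v" "periodic_2pi \<phi>"
    and "\<And>t. (\<phi> has_real_derivative \<phi>' t) (at t)" "continuous_on UNIV \<phi>'"
  shows "(\<integral>t. \<phi> t *\<^sub>R v t \<partial>circle_measure) = - (\<integral>t. \<phi>' t *\<^sub>R x t \<partial>circle_measure)"
proof -
  have "(\<integral>t. \<phi>' t *\<^sub>R x t \<partial>circle_measure) = - (\<integral>t. \<phi> t *\<^sub>R v t \<partial>circle_measure)"
    using assms unfolding has_weak_derivative_circle_def by blast
  then show ?thesis
    by (simp only: minus_minus)
qed

text \<open>Against any test function both candidates integrate to the same value, determined by
  \<open>x\<close>, so their difference is orthogonal to all of them.\<close>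

lemma has_weak_derivative_circle_unique:
  assumes "L2_circle v" "has_weak_derivative_circle x v"
    and "L2_circle w" "has_weak_derivative_circle x w"
  shows "AE t in circle_measure. v t = w t"
proof -
  note int = integrable_L2_circle[OF assms(1)] integrable_L2_circle[OF assms(3)]
  have "AE t in circle_measure. v t - w t = 0"
  proof (rule AE_eq_0_if_orthogonal_to_C1)
    show "integrable circle_measure (\<lambda>t. v t - w t)"
      using int by simp
    fix \<phi> \<phi>' :: "real \<Rightarrow> real"
    assume \<phi>: "periodic_2pi \<phi>" "\<And>t. (\<phi> has_real_derivative \<phi>' t) (at t)"
      "continuous_on UNIV \<phi>'"
    have "continuous_on {0..2 * pi} \<phi>"
      using \<phi>(2) by (meson DERIV_isCont continuous_at_imp_continuous_on)
    then have "(\<integral>t. \<phi> t *\<^sub>R (v t - w t) \<partial>circle_measure)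
        = (\<integral>t. \<phi> t *\<^sub>R v t \<partial>circle_measure) - (\<integral>t. \<phi> t *\<^sub>R w t \<partial>circle_measure)"
      using int by (simp add: scaleR_diff_right integrable_circle_scaleR)
    also have "(\<integral>t. \<phi> t *\<^sub>R v t \<partial>circle_measure) = - (\<integral>t. \<phi>' t *\<^sub>R x t \<partial>circle_measure)"
      using has_weak_derivative_circleD[OF assms(2) \<phi>] .
    also have "(\<integral>t. \<phi> t *\<^sub>R w t \<partial>circle_measure) = - (\<integral>t. \<phi>' t *\<^sub>R x t \<partial>circle_measure)"
      using has_weak_derivative_circleD[OF assms(4) \<phi>] .
    finally show "(\<integral>t. \<phi> t *\<^sub>R (v t - w t) \<partial>circle_measure) = 0"
      by simp
  qed
  then show ?thesis by simp
qed

lemma has_weak_derivative_circle_scaleR: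
  assumes "has_weak_derivative_circle x v"
  shows "has_weak_derivative_circle (\<lambda>t. l *\<^sub>R x t) (\<lambda>t. l *\<^sub>R v t)"
  unfolding has_weak_derivative_circle_def
proof (intro allI impI)
  fix \<phi> \<phi>' :: "real \<Rightarrow> real"
  assume \<phi>: "periodic_2pi \<phi> \<and> (\<forall>t. (\<phi> has_real_derivative \<phi>' t) (at t)) \<and> continuous_on UNIV \<phi>'"
  show "(\<integral>t. \<phi>' t *\<^sub>R l *\<^sub>R x t \<partial>circle_measure) = - (\<integral>t. \<phi> t *\<^sub>R l *\<^sub>R v t \<partial>circle_measure)"
    unfolding scaleR_left_commute[of _ l] integral_scaleR_right scaleR_minus_right[symmetric]
    using assms \<phi> unfolding has_weak_derivative_circle_def by (intro arg_cong[of _ _ "(*\<^sub>R) l"]) blast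
qed

lemma L2_circle_scaleR:
  assumes "L2_circle v"
  shows "L2_circle (\<lambda>t. l *\<^sub>R v t)"
  using assms unfolding L2_circle_def by (auto simp: power_mult_distrib)

lemma weak_derivative_circle:
  assumes "x \<in> H1_circle"
  shows "L2_circle (weak_derivative_circle x)"
    and "has_weak_derivative_circle x (weak_derivative_circle x)"
  using someI_ex[of "\<lambda>v. L2_circle v \<and> has_weak_derivative_circle x v"] assms
  unfolding H1_circle_def weak_derivative_circle_def by auto

lemma H1_circle_scaleR:
  assumes "x \<in> H1_circle"
  shows "(\<lambda>t. l *\<^sub>R x t) \<in> H1_circle"
proof -
  obtain v where "L2_circle v" "has_weak_derivative_circle x v"
    and x: "periodic_2pi x" "continuous_on UNIV x"
    using assms unfolding H1_circle_def by blast
  then have "\<exists>v. L2_circle v \<and> has_weak_derivative_circle (\<lambda>t. l *\<^sub>R x t) v"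
    using L2_circle_scaleR has_weak_derivative_circle_scaleR by blast
  moreover have "continuous_on UNIV (\<lambda>t. l *\<^sub>R x t)"
    by (intro continuous_intros x)
  ultimately show ?thesis
    using x(1) by (simp add: H1_circle_def periodic_2pi_def)
qed

text \<open>The representatives for \<open>x\<close> and for the scaled curve are chosen
  independently by \<open>SOME\<close>; only uniqueness relates them, hence almost
  everywhere.\<close>

lemma weak_derivative_circle_scaleR:
  assumes "x \<in> H1_circle"
  shows "AE t in circle_measure.
    weak_derivative_circle (\<lambda>t. l *\<^sub>R x t) t = l *\<^sub>R weak_derivative_circle x t"
  by (intro has_weak_derivative_circle_unique[where x = "\<lambda>t. l *\<^sub>R x t"]
      weak_derivative_circle H1_circle_scaleR L2_circle_scaleR
      has_weak_derivative_circle_scaleR assms)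

section \<open>Curves with vanishing weak derivative\<close>

lemma periodic_2pi_antiderivative:
  fixes \<psi> :: "real \<Rightarrow> real"
  assumes \<psi>: "continuous_on UNIV \<psi>" "periodic_2pi \<psi>"
    and mean: "(\<integral>t. \<psi> t \<partial>circle_measure) = 0"
  obtains \<Psi> where "periodic_2pi \<Psi>" "\<And>t. (\<Psi> has_real_derivative \<psi> t) (at t)"
proof -
  have "isCont \<psi> t" for t
    using \<psi>(1) by (simp add: continuous_on_eq_continuous_at)
  then obtain \<Psi> where \<Psi>: "\<And>t. (\<Psi> has_real_derivative \<psi> t) (at t)"
    using einterval_antiderivative[of "-\<infinity>" "\<infinity>" \<psi>]
    by (auto simp: has_real_derivative_iff_has_vector_derivative)
  have shift: "((\<lambda>t. \<Psi> (t + 2 * pi)) has_real_derivative \<psi> t) (at t)" for t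
    using \<Psi>[of "t + 2 * pi"] \<psi>(2) by (simp add: DERIV_shift periodic_2pi_def)
  \<comment> \<open>The increment of \<open>\<Psi>\<close> over a period is thus constant, and at 0
    it equals the integral of \<open>\<psi>\<close> over the period, which is 0.\<close>
  have "((\<lambda>t. \<Psi> (t + 2 * pi) - \<Psi> t) has_real_derivative 0) (at t)" for t
    using DERIV_diff[OF shift \<Psi>] by simp
  then have const: "\<Psi> (t + 2 * pi) - \<Psi> t = \<Psi> (0 + 2 * pi) - \<Psi> 0" for t
    using DERIV_isconst_all by blast
  have "(\<psi> has_integral \<Psi> (2 * pi) - \<Psi> 0) {0..2 * pi}"
    using \<Psi> by (intro fundamental_theorem_of_calculus)
      (auto intro: has_field_derivative_at_within
        simp flip: has_real_derivative_iff_has_vector_derivative)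
  moreover have "(\<psi> has_integral 0) {0..2 * pi}"
    using has_integral_integral_lebesgue_on[of "{0..2 * pi}" \<psi>] mean
      continuous_imp_integrable_real[OF continuous_on_subset[OF \<psi>(1)]] by simp
  ultimately have "\<Psi> (2 * pi) = \<Psi> 0"
    using has_integral_unique[of \<psi>] by (metis eq_iff_diff_eq_0)
  then have "periodic_2pi \<Psi>"
    using const by (simp add: periodic_2pi_def)
  then show thesis
    using \<Psi> that by blast
qed

text \<open>The integral of the continuous function \<open>norm (f t)\<close> is 0, so
  \<open>f\<close> vanishes on one closed period; periodicity carries this to the line.\<close>

lemma AE_circle_eq_0_continuous:
  fixes f :: "real \<Rightarrow> 'b::euclidean_space"
  assumes f: "continuous_on UNIV f" "periodic_2pi f" and AE: "AE t in circle_measure. f t = 0"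
  shows "f t = 0"
proof -
  have cont: "continuous_on {0..2 * pi} (\<lambda>t. norm (f t))"
    by (intro continuous_intros continuous_on_subset[OF f(1)]) auto
  have "integral {0..2 * pi} (\<lambda>t. norm (f t)) = (\<integral>t. norm (f t) \<partial>circle_measure)"
    using continuous_imp_integrable_real[OF cont] by (simp add: lebesgue_integral_eq_integral)
  also have "\<dots> = 0"
    using AE by (intro integral_eq_zero_AE) simp
  finally have zero: "f s = 0" if "s \<in> {0..2 * pi}" for s
    using integral_eq_0_iff[OF cont] that by auto
  interpret periodic_fun_simple f "2 * pi"
    using f(2) by unfold_locales (simp add: periodic_2pi_def)
  define k where "k = \<lfloor>t / (2 * pi)\<rfloor>"
  have "of_int k \<le> t / (2 * pi)" "t / (2 * pi) \<le> of_int k + 1"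
    unfolding k_def by linarith+
  then have "t - of_int k * (2 * pi) \<in> {0..2 * pi}"
    by (simp add: field_simps)
  then show ?thesis
    using zero[of "t - of_int k * (2 * pi)"] minus_of_int[of t k] by simp
qed

text \<open>The du Bois-Reymond argument on the circle: \<open>x\<close> minus its mean
  \<open>c\<close> is orthogonal to every test function.\<close>

lemma has_weak_derivative_circle_0_imp_constant:
  fixes x :: "real \<Rightarrow> 'b::euclidean_space"
  assumes x: "continuous_on UNIV x" "periodic_2pi x"
    and v: "has_weak_derivative_circle x v" "AE t in circle_measure. v t = 0"
  shows "x constant_on UNIV"
proof -
  have circ: "integrable circle_measure f" if "continuous_on UNIV f"
    for f :: "real \<Rightarrow> 'c::euclidean_space"
    using continuous_imp_integrable_real continuous_on_subset[OF that] by blast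
  define c where "c = (1 / (2 * pi)) *\<^sub>R (\<integral>t. x t \<partial>circle_measure)"
  have u: "integrable circle_measure (\<lambda>t. x t - c)"
    by (intro circ continuous_intros x)
  have "AE t in circle_measure. x t - c = 0"
  proof (rule AE_eq_0_if_orthogonal_to_C1[OF u])
    fix \<phi> \<phi>' :: "real \<Rightarrow> real"
    assume \<phi>: "periodic_2pi \<phi>" "\<And>t. (\<phi> has_real_derivative \<phi>' t) (at t)"
    have c\<phi>: "continuous_on A \<phi>" for A
      using \<phi>(2) by (meson DERIV_isCont continuous_at_imp_continuous_on)
    \<comment> \<open>Without its mean, \<open>\<phi>\<close> has a periodic antiderivative
      \<open>\<Psi>\<close>, which is itself an admissible test function for
      \<open>v\<close>.\<close>
    define \<mu> where "\<mu> = (\<integral>t. \<phi> t \<partial>circle_measure) / (2 * pi)"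
    have "(\<integral>t. \<phi> t - \<mu> \<partial>circle_measure) = 0"
      using circ[OF c\<phi>] circ[of "\<lambda>_. \<mu>"]
      by (simp add: \<mu>_def measure_restrict_space)
    moreover have "continuous_on UNIV (\<lambda>t. \<phi> t - \<mu>)" "periodic_2pi (\<lambda>t. \<phi> t - \<mu>)"
      using \<phi>(1) by (auto intro!: continuous_intros c\<phi> simp: periodic_2pi_def)
    ultimately obtain \<Psi>
      where \<Psi>: "periodic_2pi \<Psi>" "\<And>t. (\<Psi> has_real_derivative \<phi> t - \<mu>) (at t)"
      using periodic_2pi_antiderivative[of "\<lambda>t. \<phi> t - \<mu>"] by blast
    have "(\<integral>t. \<Psi> t *\<^sub>R v t \<partial>circle_measure) = - (\<integral>t. (\<phi> t - \<mu>) *\<^sub>R x t \<partial>circle_measure)"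
      by (intro has_weak_derivative_circleD[OF v(1)] \<Psi> continuous_intros c\<phi>)
    moreover have "(\<integral>t. \<Psi> t *\<^sub>R v t \<partial>circle_measure) = 0"
      using v(2) by (intro integral_eq_zero_AE) auto
    ultimately have "(\<integral>t. (\<phi> t - \<mu>) *\<^sub>R x t \<partial>circle_measure) = 0"
      by simp
    moreover have "(\<integral>t. (\<phi> t - \<mu>) *\<^sub>R x t \<partial>circle_measure)
        = (\<integral>t. \<phi> t *\<^sub>R x t \<partial>circle_measure) - \<mu> *\<^sub>R (\<integral>t. x t \<partial>circle_measure)"
      using integrable_circle_scaleR[OF circ[OF x(1)] c\<phi>] circ[OF x(1)]
      by (simp add: scaleR_diff_left)
    \<comment> \<open>Both sides are the product of the integrals of \<open>\<phi>\<close> and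
      \<open>x\<close> over \<open>2 * pi\<close>: removing the mean from \<open>\<phi>\<close>
      amounts to removing it from \<open>x\<close>.\<close>
    moreover have "\<mu> *\<^sub>R (\<integral>t. x t \<partial>circle_measure) = (\<integral>t. \<phi> t *\<^sub>R c \<partial>circle_measure)"
      using circ[OF c\<phi>] by (simp add: \<mu>_def c_def)
    moreover have "(\<integral>t. \<phi> t *\<^sub>R x t \<partial>circle_measure) - (\<integral>t. \<phi> t *\<^sub>R c \<partial>circle_measure)
        = (\<integral>t. \<phi> t *\<^sub>R (x t - c) \<partial>circle_measure)"
      using integrable_circle_scaleR[OF circ[OF x(1)] c\<phi>] circ[OF c\<phi>]
      by (simp add: scaleR_diff_right)
    ultimately show "(\<integral>t. \<phi> t *\<^sub>R (x t - c) \<partial>circle_measure) = 0"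
      by simp
  qed
  then have "x t - c = 0" for t
    using x by (intro AE_circle_eq_0_continuous)
      (auto intro!: continuous_intros simp: periodic_2pi_def)
  then show ?thesis
    unfolding constant_on_def by auto
qed

subsection \<open>Kinetic and potential terms\<close>

text \<open>The norm on configurations is the Euclidean combination of the norms of the bodies, so
  equal masses factor out.\<close>

lemma kinetic_eq:
  fixes x :: "real \<Rightarrow> (real^2)^'n"
  shows "kinetic m x = m / 2 * (\<integral>t. (norm (weak_derivative_circle x t))\<^sup>2 \<partial>circle_measure)"
proof -
  have "(\<Sum>i\<in>UNIV. m * (norm (w $ i))\<^sup>2) = m * (norm w)\<^sup>2" for w :: "(real^2)^'n"
    by (simp add: norm_vec_def L2_set_def sum_nonneg sum_distrib_left)
  then show ?thesis
    unfolding kinetic_def by (simp only:) simp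
qed

lemma kinetic_nonneg: "0 \<le> m \<Longrightarrow> 0 \<le> kinetic m x"
  unfolding kinetic_eq by simp

lemma kinetic_scaleR:
  assumes "x \<in> H1_circle"
  shows "kinetic m (\<lambda>t. l *\<^sub>R x t) = l\<^sup>2 * kinetic m x"
proof -
  have "(\<integral>t. (norm (weak_derivative_circle (\<lambda>t. l *\<^sub>R x t) t))\<^sup>2 \<partial>circle_measure)
      = (\<integral>t. l\<^sup>2 * (norm (weak_derivative_circle x t))\<^sup>2 \<partial>circle_measure)"
  proof (rule integral_cong_AE)
    show "AE t in circle_measure. (norm (weak_derivative_circle (\<lambda>t. l *\<^sub>R x t) t))\<^sup>2
        = l\<^sup>2 * (norm (weak_derivative_circle x t))\<^sup>2"
      using weak_derivative_circle_scaleR[OF assms, of l]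
      by eventually_elim (simp add: power_mult_distrib)
  qed (use weak_derivative_circle(1)[OF assms]
      weak_derivative_circle(1)[OF H1_circle_scaleR[OF assms, of l]] in
      \<open>auto simp: L2_circle_def\<close>)
  then show ?thesis
    unfolding kinetic_eq by simp
qed

lemma kinetic_pos:
  assumes "0 < m" "x \<in> H1_circle" "\<not> x constant_on UNIV"
  shows "0 < kinetic m x"
proof (rule ccontr)
  assume "\<not> 0 < kinetic m x"
  then have "kinetic m x = 0"
    using kinetic_nonneg[of m x] assms(1) by simp
  then have "(\<integral>t. (norm (weak_derivative_circle x t))\<^sup>2 \<partial>circle_measure) = 0"
    using assms(1) by (simp add: kinetic_eq)
  \<comment> \<open>Square integrability is essential: a Bochner integral is also 0 by default when
    the integrand is not integrable.\<close>
  then have "AE t in circle_measure. weak_derivative_circle x t = 0"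
    using weak_derivative_circle(1)[OF assms(2)]
    by (subst (asm) integral_nonneg_eq_0_iff_AE) (auto simp: L2_circle_def)
  then have "x constant_on UNIV"
    using assms(2) has_weak_derivative_circle_0_imp_constant weak_derivative_circle(2)[OF assms(2)]
    unfolding H1_circle_def by blast
  then show False
    using assms(3) by simp
qed

section \<open>Homogeneity and positivity of the potential\<close>

lemma potential_nonneg: "0 \<le> potential \<alpha> m q"
  unfolding potential_def by (auto intro!: sum_nonneg)

lemma potential_scaleR:
  assumes "0 < l"
  shows "potential \<alpha> m (l *\<^sub>R q) = l powr (- \<alpha>) * potential \<alpha> m q"
proof -
  have "norm ((l *\<^sub>R q) $ i - (l *\<^sub>R q) $ j) powr (- \<alpha>)
      = l powr (- \<alpha>) * norm (q $ i - q $ j) powr (- \<alpha>)" for i j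
    using assms by (simp add: powr_mult flip: scaleR_diff_right)
  then show ?thesis
    unfolding potential_def by (simp add: sum_distrib_left case_prod_unfold ac_simps)
qed

lemma potential_integral_nonneg: "0 \<le> potential_integral \<alpha> m x"
  unfolding potential_integral_def by (simp add: potential_nonneg)

lemma potential_integral_scaleR:
  "0 < l \<Longrightarrow> potential_integral \<alpha> m (\<lambda>t. l *\<^sub>R x t) = l powr (- \<alpha>) * potential_integral \<alpha> m x"
  unfolding potential_integral_def by (simp add: potential_scaleR)

text \<open>Since \<open>0 powr (- \<alpha>)\<close> is 0, distinct positions are what makes each
  summand positive; two bodies make the sum nonempty.\<close>

lemma potential_pos:
  fixes q :: "(real^2)^('n::{finite,linorder})"
  assumes "0 < m" "\<And>i j. i \<noteq> j \<Longrightarrow> q $ i \<noteq> q $ j" "2 \<le> CARD('n)"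
  shows "0 < potential \<alpha> m q"
  unfolding potential_def
proof (rule sum_pos)
  have "\<exists>i j :: 'n. i \<noteq> j"
    using assms(3) card_le_Suc0_iff_eq[of "UNIV :: 'n set"] by auto
  then obtain i j :: 'n where "i < j"
    by (meson neq_iff)
  then show "{(i, j :: 'n). i < j} \<noteq> {}"
    by auto
qed (use assms in \<open>auto split: prod.splits\<close>)

lemma potential_integral_pos:
  fixes x :: "real \<Rightarrow> (real^2)^('n::{finite,linorder})"
  assumes "0 < m" "continuous_on UNIV x" "collision_free x" "2 \<le> CARD('n)"
  shows "0 < potential_integral \<alpha> m x"
proof -
  have pos: "0 < potential \<alpha> m (x t)" for t
    using assms by (intro potential_pos) (auto simp: collision_free_def)
  \<comment> \<open>Absence of collisions keeps the bases of \<open>powr\<close> away from 0, where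
    continuity could fail.\<close>
  have cont: "continuous_on {0..2 * pi} (\<lambda>t. potential \<alpha> m (x t))"
    unfolding potential_def case_prod_unfold using assms(3)
    by (intro continuous_intros continuous_on_subset[OF assms(2)]) (auto simp: collision_free_def)
  have "potential_integral \<alpha> m x = integral {0..2 * pi} (\<lambda>t. potential \<alpha> m (x t))"
    unfolding potential_integral_def using continuous_imp_integrable_real[OF cont]
    by (simp add: lebesgue_integral_eq_integral)
  moreover have "integral {0..2 * pi} (\<lambda>t. potential \<alpha> m (x t)) \<noteq> 0"
    using integral_eq_0_iff[OF cont] pos[of 0] potential_nonneg by fastforce
  ultimately show ?thesis
    using potential_integral_nonneg[of \<alpha> m x] by simp
qed

subsection \<open>Minimisation over the scaling parameter\<close>

lemma scaling_constant_le:
  fixes \<alpha> K V l :: real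
  assumes "0 < \<alpha>" "0 \<le> K" "0 \<le> V" "0 < l"
  shows "scaling_constant \<alpha> * (K powr (\<alpha> / (\<alpha> + 2)) * V powr (2 / (\<alpha> + 2)))
    \<le> l\<^sup>2 * K + l powr (- \<alpha>) * V"
proof (cases "K = 0 \<or> V = 0")
  case True
  \<comment> \<open>A power with base 0 is 0, so the left side vanishes.\<close>
  then show ?thesis
    using assms by auto
next
  case False
  then have KV: "0 < K" "0 < V"
    using assms by auto
  define p where "p = \<alpha> / (\<alpha> + 2)"
  define q where "q = 2 / (\<alpha> + 2)"
  have pq: "0 < p" "0 < q" "p + q = 1" "p = \<alpha> / 2 * q" "2 * p = \<alpha> * q"
    using assms by (auto simp: p_def q_def simp flip: add_divide_distrib)
  \<comment> \<open>Dividing by the weights turns the weighted sum into the two terms of the action;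
    \<open>2 * p = \<alpha> * q\<close> cancels the powers of \<open>l\<close> in the
    product.\<close>
  have "((l\<^sup>2 * K) / p) powr p * ((l powr (- \<alpha>) * V) / q) powr q
      \<le> p * ((l\<^sup>2 * K) / p) + q * ((l powr (- \<alpha>) * V) / q)"
    using assms(4) pq(1-3) KV by (intro Youngs_inequality_0) auto
  also have "\<dots> = l\<^sup>2 * K + l powr (- \<alpha>) * V"
    using pq by simp
  also have "((l\<^sup>2 * K) / p) powr p * ((l powr (- \<alpha>) * V) / q) powr q
      = (l\<^sup>2 powr p * (l powr (- \<alpha>)) powr q) * (K powr p * V powr q) / (p powr p * q powr q)"
    using assms pq by (simp add: powr_mult powr_divide field_simps)
  also have "l\<^sup>2 powr p * (l powr (- \<alpha>)) powr q = 1"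
  proof -
    have "l\<^sup>2 powr p = l powr (2 * p)"
      using assms by (metis powr_numeral powr_powr less_imp_le)
    moreover have "(l powr (- \<alpha>)) powr q = l powr (- (2 * p))"
      by (simp add: powr_powr pq(5))
    ultimately show ?thesis
      using assms(4) by (simp add: powr_minus)
  qed
  also have "1 * (K powr p * V powr q) / (p powr p * q powr q)
      = scaling_constant \<alpha> * (K powr p * V powr q)"
  \<comment> \<open>As \<open>p\<close> is \<open>\<alpha> / 2\<close> times \<open>q\<close> and
    \<open>p + q = 1\<close>, the denominator collapses to
    \<open>(\<alpha> / 2) powr p * q\<close>.\<close>
  proof -
    have "p powr p * q powr q = (\<alpha> / 2) powr p * (q powr p * q powr q)"
      using assms pq(2) unfolding pq(4) by (simp add: powr_mult powr_divide)
    also have "q powr p * q powr q = q powr (p + q)"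
      by (simp only: powr_add)
    also have "\<dots> = q"
      using pq(2,3) by simp
    finally have "p powr p * q powr q = (\<alpha> / 2) powr p * q" .
    moreover have "scaling_constant \<alpha> = 1 / ((\<alpha> / 2) powr p * q)"
      unfolding scaling_constant_def p_def[symmetric] by (simp add: powr_minus_divide q_def)
    ultimately show ?thesis
      by simp
  qed
  finally show ?thesis unfolding p_def q_def .
qed

lemma scaling_constant_attained:
  fixes \<alpha> K V :: real
  assumes "0 < \<alpha>" "0 < K" "0 < V"
  obtains l where "0 < l" "l\<^sup>2 * K + l powr (- \<alpha>) * V
    = scaling_constant \<alpha> * (K powr (\<alpha> / (\<alpha> + 2)) * V powr (2 / (\<alpha> + 2)))"
proof
  define p where "p = \<alpha> / (\<alpha> + 2)"
  define q where "q = 2 / (\<alpha> + 2)"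
  have pq: "p + q = 1"
    using assms by (simp add: p_def q_def flip: add_divide_distrib)
  define c where "c = \<alpha> / 2"
  \<comment> \<open>The zero of the derivative
    \<open>2 * l * K - \<alpha> * l powr (- \<alpha> - 1) * V\<close>.\<close>
  define l where "l = (c * V / K) powr (1 / (\<alpha> + 2))"
  have c: "0 < c" using assms by (simp add: c_def)
  have pos: "0 < c * V / K" using assms c by simp
  then show "0 < (\<alpha> / 2 * V / K) powr (1 / (\<alpha> + 2))"
    using assms by simp
  have "l\<^sup>2 = (c * V / K) powr q"
    using pos by (simp add: l_def q_def powr_powr flip: powr_numeral)
  also have "\<dots> * K = (c powr q * V powr q) * (K / K powr q)"
    using assms c by (simp add: powr_mult powr_divide)
  also have "K / K powr q = K powr p"
    using assms pq by (metis add_diff_cancel_right' powr_diff powr_one less_imp_le)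
  finally have 1: "l\<^sup>2 * K = c powr q * (K powr p * V powr q)"
    by simp
  have "l powr (- \<alpha>) = (c * V / K) powr (- p)"
    using pos by (simp add: l_def p_def powr_powr)
  also have "\<dots> * V = (c powr (- p) * K powr p) * (V / V powr p)"
    using assms c by (simp add: powr_mult powr_divide powr_minus field_simps)
  also have "V / V powr p = V powr q"
    using assms pq by (metis add_diff_cancel_left' powr_diff powr_one less_imp_le)
  finally have 2: "l powr (- \<alpha>) * V = c powr (- p) * (K powr p * V powr q)"
    by simp
  \<comment> \<open>The two coefficients then add up to \<open>(c + 1) * c powr (- p)\<close>, and
    \<open>c + 1 = (\<alpha> + 2) / 2\<close>.\<close>
  have "q = 1 - p"
    using pq by simp
  then have "c powr q = c * c powr (- p)"
    using c by (simp add: powr_diff powr_minus divide_inverse)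
  then have "c powr q + c powr (- p) = scaling_constant \<alpha>"
    unfolding scaling_constant_def p_def[symmetric] c_def by (simp add: field_simps)
  then have "l\<^sup>2 * K + l powr (- \<alpha>) * V = scaling_constant \<alpha> * (K powr p * V powr q)"
    unfolding 1 2 by (simp flip: distrib_right)
  then show "((\<alpha> / 2 * V / K) powr (1 / (\<alpha> + 2)))\<^sup>2 * K
      + ((\<alpha> / 2 * V / K) powr (1 / (\<alpha> + 2))) powr (- \<alpha>) * V
    = scaling_constant \<alpha> * (K powr (\<alpha> / (\<alpha> + 2)) * V powr (2 / (\<alpha> + 2)))"
    unfolding l_def p_def q_def c_def .
qed

text \<open>Includes the degenerate cases, where the right side is just \<open>e\<close> and no
  exact minimiser need exist.\<close>

lemma scaling_constant_approached:
  fixes \<alpha> K V e :: real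
  assumes "0 < \<alpha>" "0 \<le> K" "0 \<le> V" "0 < e"
  obtains l where "0 < l" "l\<^sup>2 * K + l powr (- \<alpha>) * V
    \<le> scaling_constant \<alpha> * (K powr (\<alpha> / (\<alpha> + 2)) * V powr (2 / (\<alpha> + 2))) + e"
proof -
  consider "0 < K" "0 < V" | "K = 0" | "V = 0"
    using assms by fastforce
  then show thesis
  proof cases
    case 1
    then obtain l where "0 < l" "l\<^sup>2 * K + l powr (- \<alpha>) * V
        = scaling_constant \<alpha> * (K powr (\<alpha> / (\<alpha> + 2)) * V powr (2 / (\<alpha> + 2)))"
      using scaling_constant_attained[OF assms(1)] by blast
    then show thesis
      using assms(4) by (intro that[of l]) auto
  next
    case 2
    \<comment> \<open>The goal is now \<open>V \<le> e * l powr \<alpha>\<close>; the summand 1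
      keeps \<open>l\<close> positive when \<open>V = 0\<close>.\<close>
    define l where "l = (V / e + 1) powr (1 / \<alpha>)"
    have pos: "0 < V / e + 1" using assms by (simp add: add_nonneg_pos)
    have "l powr (- \<alpha>) * V = V / (V / e + 1)"
      using pos assms by (simp add: l_def powr_powr powr_minus divide_inverse)
    also have "\<dots> \<le> e"
      using pos assms by (subst pos_divide_le_eq) (auto simp: distrib_left)
    finally have "l powr (- \<alpha>) * V \<le> e" .
    then show thesis
      using 2 pos by (intro that[of l]) (auto simp: l_def)
  next
    case 3
    \<comment> \<open>Here \<open>l\<^sup>2 = e / (K + 1)\<close>, with \<open>K + 1\<close> in
      place of \<open>K\<close> to allow \<open>K = 0\<close>.\<close>
    have "e / (K + 1) * K \<le> e"
      using assms by (simp add: field_simps)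
    then show thesis
      using 3 assms by (intro that[of "sqrt (e / (K + 1))"]) auto
  qed
qed

lemma INF_scaling:
  fixes \<alpha> K V :: real
  assumes "0 < \<alpha>" "0 \<le> K" "0 \<le> V"
  shows "bdd_below ((\<lambda>l. l\<^sup>2 * K + l powr (- \<alpha>) * V) ` {0<..})"
    and "(INF l\<in>{0<..}. l\<^sup>2 * K + l powr (- \<alpha>) * V)
      = scaling_constant \<alpha> * (K powr (\<alpha> / (\<alpha> + 2)) * V powr (2 / (\<alpha> + 2)))"
proof -
  show bdd: "bdd_below ((\<lambda>l. l\<^sup>2 * K + l powr (- \<alpha>) * V) ` {0<..})"
    using scaling_constant_le[OF assms] by (auto intro!: bdd_belowI2)
  show "(INF l\<in>{0<..}. l\<^sup>2 * K + l powr (- \<alpha>) * V)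
      = scaling_constant \<alpha> * (K powr (\<alpha> / (\<alpha> + 2)) * V powr (2 / (\<alpha> + 2)))"
  proof (rule antisym)
    show "(INF l\<in>{0<..}. l\<^sup>2 * K + l powr (- \<alpha>) * V)
      \<le> scaling_constant \<alpha> * (K powr (\<alpha> / (\<alpha> + 2)) * V powr (2 / (\<alpha> + 2)))"
    proof (rule field_le_epsilon)
      fix e :: real
      assume "0 < e"
      then obtain l where "0 < l" "l\<^sup>2 * K + l powr (- \<alpha>) * V
          \<le> scaling_constant \<alpha> * (K powr (\<alpha> / (\<alpha> + 2)) * V powr (2 / (\<alpha> + 2))) + e"
        using scaling_constant_approached[OF assms] by blast
      then show "(INF l\<in>{0<..}. l\<^sup>2 * K + l powr (- \<alpha>) * V)
          \<le> scaling_constant \<alpha> * (K powr (\<alpha> / (\<alpha> + 2)) * V powr (2 / (\<alpha> + 2))) + e"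
        by (intro cINF_lower2[OF bdd, of l]) simp_all
    qed
    show "scaling_constant \<alpha> * (K powr (\<alpha> / (\<alpha> + 2)) * V powr (2 / (\<alpha> + 2)))
        \<le> (INF l\<in>{0<..}. l\<^sup>2 * K + l powr (- \<alpha>) * V)"
      by (rule cINF_greatest) (simp_all add: scaling_constant_le[OF assms])
  qed
qed

text \<open>A constant curve has K = 0 and a single body has V = 0, and the infimum 0 may then be
  missed; attainment is therefore claimed for nonconstant curves of at least two bodies.
  \<open>bdd_below\<close> makes \<open>INF\<close> on the reals a genuine infimum.\<close>

theorem mainTheorem4:
  fixes \<alpha> m :: real and x :: "real \<Rightarrow> (real^2)^('n::{finite,linorder})"
  assumes "0 < \<alpha>" and "\<alpha> \<le> 2" and "0 < m" and "x \<in> collision_free_curves"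
  shows "(\<forall>l>0. scaled_action \<alpha> m l x =
                  l\<^sup>2 * kinetic m x + l powr (- \<alpha>) * potential_integral \<alpha> m x)
    \<and> bdd_below ((\<lambda>l. scaled_action \<alpha> m l x) ` {0<..})
    \<and> (INF l\<in>{0<..}. scaled_action \<alpha> m l x)
          = scaling_constant \<alpha> * scale_invariant_functional \<alpha> m x
    \<and> (CARD('n) \<ge> 2 \<and> \<not> x constant_on UNIV \<longrightarrow>
          (\<exists>l>0. scaled_action \<alpha> m l x = scaling_constant \<alpha> * scale_invariant_functional \<alpha> m x
               \<and> (\<forall>l'>0. scaled_action \<alpha> m l x \<le> scaled_action \<alpha> m l' x)))"
proof -
  have x: "x \<in> H1_circle" "collision_free x" "continuous_on UNIV x"
    using assms(4) by (auto simp: collision_free_curves_def H1_circle_def)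
  let ?K = "kinetic m x" and ?V = "potential_integral \<alpha> m x"
  have KV: "0 \<le> ?K" "0 \<le> ?V"
    using assms(3) by (simp_all add: kinetic_nonneg potential_integral_nonneg)
  have eq: "scaled_action \<alpha> m l x = l\<^sup>2 * ?K + l powr (- \<alpha>) * ?V" if "0 < l" for l
    unfolding scaled_action_def action_def
    using that x(1) by (simp add: kinetic_scaleR potential_integral_scaleR)
  then have img: "(\<lambda>l. scaled_action \<alpha> m l x) ` {0<..}
      = (\<lambda>l. l\<^sup>2 * ?K + l powr (- \<alpha>) * ?V) ` {0<..}"
    by (intro image_cong) auto
  have "\<exists>l>0. scaled_action \<alpha> m l x = scaling_constant \<alpha> * scale_invariant_functional \<alpha> m x
      \<and> (\<forall>l'>0. scaled_action \<alpha> m l x \<le> scaled_action \<alpha> m l' x)"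
    if "2 \<le> CARD('n)" "\<not> x constant_on UNIV"
  proof -
    have "0 < ?K" "0 < ?V"
      using kinetic_pos potential_integral_pos x that assms(3) by blast+
    then obtain l where "0 < l" "l\<^sup>2 * ?K + l powr (- \<alpha>) * ?V
        = scaling_constant \<alpha> * scale_invariant_functional \<alpha> m x"
      unfolding scale_invariant_functional_def
      using scaling_constant_attained[OF assms(1)] by blast
    then have min: "scaled_action \<alpha> m l x = scaling_constant \<alpha> * scale_invariant_functional \<alpha> m x"
      by (simp only: eq)
    moreover have "scaled_action \<alpha> m l x \<le> scaled_action \<alpha> m l' x" if "0 < l'" for l'
      unfolding min eq[OF that] scale_invariant_functional_def
      by (rule scaling_constant_le[OF assms(1) KV that])
    ultimately show ?thesis
      using \<open>0 < l\<close> by blast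
  qed
  moreover have "bdd_below ((\<lambda>l. scaled_action \<alpha> m l x) ` {0<..})"
    "(INF l\<in>{0<..}. scaled_action \<alpha> m l x)
      = scaling_constant \<alpha> * scale_invariant_functional \<alpha> m x"
    unfolding img scale_invariant_functional_def by (rule INF_scaling[OF assms(1) KV])+
  ultimately show ?thesis
    using eq by blast
qed

end
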